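(* Almost every finite metric space admits a microscopic weighting: for each $n\ge 1$, the space of all $n$-point metric spaces contains a dense open subset such that every metric space in this subset admits a microscopic weighting.
   Context: The space of all $n$-point metric spaces is the set of $n\times n$ real matrices $D=(d_{ij})$ which are distance matrices of a metric on $\{1,\dots,n\}$ (i.e. $d_{ii}=0$, $d_{ij}=d_{ji}>0$ for $i\ne j$, and $d_{ik}\le d_{ij}+d_{jk}$), with the subspace topology from $\mathbb{R}^{n\times n}$; "dense" and "open" are relative to this space. For a finite metric space $X=\{x_1,\dots,x_n\}$ with metric $d$ and $t>0$, let $Z(t)=(e^{-t d(x_i,x_j)})_{i,j}$, and let $\mathbf{1}=(1,\dots,1)^{\mathrm T}\in\mathbb{R}^n$. For all sufficiently small $t>0$, $Z(t)$ is invertible; put $\mathbf{w}(t)=Z(t)^{-1}\mathbf{1}$. $X$ admits a microscopic weighting if $\lim_{t\to0^+}\mathbf{w}(t)$ exists componentwise in $\mathbb{R}^n$. *)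

theory Defs
  imports "HOL-Analysis.Analysis"
begin

text \<open>An \<open>n\<close>-point metric space is given by its distance matrix, indexed by a finite type
  with \<open>n\<close> elements.\<close>

definition metric_matrices :: "(real ^ 'n ^ 'n) set" where
  "metric_matrices = {D. Metric_space UNIV (\<lambda>i j. D $ i $ j)}"

lemma metric_matrices_iff:
  fixes D :: "real ^ 'n ^ 'n"
  shows "D \<in> metric_matrices \<longleftrightarrow>
    (\<forall>i. D $ i $ i = 0) \<and>
    (\<forall>i j. i \<noteq> j \<longrightarrow> D $ i $ j = D $ j $ i \<and> D $ i $ j > 0) \<and>
    (\<forall>i j k. D $ i $ k \<le> D $ i $ j + D $ j $ k)"
    (is "_ \<longleftrightarrow> ?R")
proof
  assume "D \<in> metric_matrices"
  then interpret Metric_space UNIV "\<lambda>i j. D $ i $ j"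
    by (simp add: metric_matrices_def)
  show ?R
    using commute triangle by auto
next
  assume R: ?R
  have nonneg: "0 \<le> D $ i $ j" for i j
    using R by (cases "i = j") (auto simp: less_imp_le)
  have "D $ i $ j = D $ j $ i" for i j
    using R by (cases "i = j") auto
  moreover have "D $ i $ j = 0 \<longleftrightarrow> i = j" for i j
    using R by (metis less_irrefl)
  ultimately show "D \<in> metric_matrices"
    using R nonneg by (simp add: metric_matrices_def Metric_space_def)
qed

definition similarity_matrix :: "real ^ 'n ^ 'n \<Rightarrow> real \<Rightarrow> real ^ 'n ^ 'n" where
  "similarity_matrix D t = (\<chi> i j. exp (- t * D $ i $ j))"

definition weighting :: "real ^ 'n ^ 'n \<Rightarrow> real \<Rightarrow> real ^ 'n" where
  "weighting D t = matrix_inv (similarity_matrix D t) *v (\<chi> i. 1)"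

text \<open>The first conjunct holds for every metric matrix; it is stated because \<open>matrix_inv\<close> is
  unspecified on singular matrices.\<close>

definition admits_microscopic_weighting :: "real ^ 'n ^ 'n \<Rightarrow> bool" where
  "admits_microscopic_weighting D \<longleftrightarrow>
    (\<forall>\<^sub>F t in at_right 0. invertible (similarity_matrix D t)) \<and>
    (\<exists>w. \<forall>i. ((\<lambda>t. weighting D t $ i) \<longlongrightarrow> w $ i) (at_right 0))"

end

theory Submission
  imports Defs
begin

text \<open>Let \<open>J\<close> be the all-ones matrix and \<open>b(t) = J + (J - Z(t)) / t\<close>, so that
  \<open>Z(t) = (1 + t) J - t b(t)\<close> and \<open>b(t)\<close> tends to \<open>D + J\<close> as \<open>t\<close> tends to \<open>0\<close>. If \<open>b u = 1\<close> then
  \<open>Z u\<close> is the scalar \<open>(1 + t) \<Sum>u - t\<close> times the vector \<open>1\<close>, so the weighting is \<open>u\<close> divided by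
  this scalar, and it converges as soon as \<open>D + J\<close> is invertible and the entries of
  \<open>(D + J)\<^sup>-\<^sup>1 1\<close> have a nonzero sum. These are two polynomial conditions on \<open>D\<close>, hence open. The
  discrete metric \<open>J - I\<close> satisfies them, so all but finitely many points of the
  segment from any metric to the discrete one do. (Shifting \<open>D\<close> by \<open>J\<close> makes the argument
  uniform in \<open>n\<close>: for \<open>n = 1\<close> the matrix \<open>D\<close> itself is singular.)\<close>

section \<open>Determinants that depend on a parameter, and Cramer's rule\<close>

lemma tendsto_det:
  fixes f :: "'a \<Rightarrow> real ^ 'n ^ 'n"
  assumes "\<And>i j. ((\<lambda>x. f x $ i $ j) \<longlongrightarrow> A $ i $ j) F"
  shows "((\<lambda>x. det (f x)) \<longlongrightarrow> det A) F"
  unfolding det_def by (intro tendsto_intros assms)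

lemma real_polynomial_function_det:
  fixes f :: "real \<Rightarrow> real ^ 'n ^ 'n"
  assumes "\<And>i j. real_polynomial_function (\<lambda>x. f x $ i $ j)"
  shows "real_polynomial_function (\<lambda>x. det (f x))"
  unfolding det_def
  by (intro real_polynomial_function_sum real_polynomial_function_prod
      real_polynomial_function.intros assms finite_permutations) auto

lemma finite_roots_real_polynomial_function:
  fixes p :: "real \<Rightarrow> real"
  assumes "real_polynomial_function p" "p a \<noteq> 0"
  shows "finite {x. p x = 0}"
proof -
  obtain c n where p: "p = (\<lambda>x. \<Sum>i\<le>n. c i * x ^ i)"
    using assms(1) real_polynomial_function_iff_sum by blast
  have "\<exists>k\<le>n. c k \<noteq> 0"
    using assms(2) unfolding p by (metis (no_types, lifting) atMost_iff mult_eq_0_iff sum.neutral)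
  then show ?thesis
    unfolding p by (auto intro: polyfun_roots_finite)
qed

text \<open>The numerator in Cramer's rule for \<open>A x = 1\<close>, that is, entry
  \<open>k\<close> of adj(A) 1. Being a polynomial in the entries of \<open>A\<close>, it makes
  sense for singular \<open>A\<close> too.\<close>

definition ones_column_det :: "real ^ 'n ^ 'n \<Rightarrow> 'n \<Rightarrow> real" where
  "ones_column_det A k = det (\<chi> i j. if j = k then 1 else A $ i $ j)"

lemma matrix_vector_eq_one_iff:
  fixes A :: "real ^ 'n ^ 'n"
  assumes "det A \<noteq> 0"
  shows "A *v x = 1 \<longleftrightarrow> x = (\<chi> k. ones_column_det A k / det A)"
  using cramer[OF assms, of x 1] by (simp add: ones_column_det_def cong: if_cong)

lemma tendsto_ones_column_det:
  fixes f :: "'a \<Rightarrow> real ^ 'n ^ 'n"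
  assumes "\<And>i j. ((\<lambda>x. f x $ i $ j) \<longlongrightarrow> A $ i $ j) F"
  shows "((\<lambda>x. ones_column_det (f x) k) \<longlongrightarrow> ones_column_det A k) F"
  unfolding ones_column_det_def by (rule tendsto_det) (simp add: assms)

lemma real_polynomial_function_ones_column_det:
  fixes f :: "real \<Rightarrow> real ^ 'n ^ 'n"
  assumes "\<And>i j. real_polynomial_function (\<lambda>x. f x $ i $ j)"
  shows "real_polynomial_function (\<lambda>x. ones_column_det (f x) k)"
  unfolding ones_column_det_def
proof (rule real_polynomial_function_det)
  show "real_polynomial_function (\<lambda>x. (\<chi> i j. if j = k then 1 else f x $ i $ j) $ i $ j)" for i j
    by (cases "j = k") (auto simp: assms intro: real_polynomial_function.intros)
qed

section \<open>Inverting a perturbation of the all-ones matrix\<close>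

lemma matrix_inv_left_inverse:
  fixes A :: "real ^ 'n ^ 'n"
  assumes "invertible A"
  shows "matrix_inv A ** A = mat 1"
  using assms unfolding invertible_def matrix_inv_def by (metis (mono_tags, lifting) someI_ex)

text \<open>The constant \<open>1\<close> is entrywise, so this is the all-ones matrix, of rank one;
  the identity matrix is \<open>mat 1\<close>.\<close>

lemma one_matrix_vector_mult:
  fixes x :: "real ^ 'n"
  shows "(1 :: real ^ 'n ^ 'm) *v x = (\<Sum>j\<in>UNIV. x $ j) *\<^sub>R 1"
  by (simp add: matrix_vector_mult_def vec_eq_iff)

text \<open>As the all-ones matrix has rank one, \<open>Z x = 0\<close> forces \<open>b x\<close> to
  be a multiple of \<open>1\<close>, hence \<open>x\<close> to be a multiple of \<open>u\<close>.
  But \<open>Z\<close> sends \<open>u\<close> to a nonzero multiple of \<open>1\<close>, so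
  \<open>x = 0\<close>; the same scalar gives the inverse on \<open>1\<close>.\<close>

lemma invertible_ones_minus_matrix:
  fixes b Z :: "real ^ 'n ^ 'n"
  assumes Z: "Z = (1 + t) *\<^sub>R 1 - t *\<^sub>R b"
    and b: "det b \<noteq> 0" "b *v u = 1"
    and t: "t \<noteq> 0" and c: "(1 + t) * (\<Sum>j\<in>UNIV. u $ j) - t \<noteq> 0"
  shows "invertible Z"
    and "matrix_inv Z *v 1 = (1 / ((1 + t) * (\<Sum>j\<in>UNIV. u $ j) - t)) *\<^sub>R u"
proof -
  define s where "s = (\<Sum>j\<in>UNIV. u $ j)"
  have Zv: "Z *v x = ((1 + t) * (\<Sum>j\<in>UNIV. x $ j)) *\<^sub>R 1 - t *\<^sub>R (b *v x)" for x
    by (simp add: Z matrix_vector_mult_diff_rdistrib scaleR_matrix_vector_assoc [symmetric]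
        one_matrix_vector_mult)
  have inj_b: "b *v x = 0 \<Longrightarrow> x = 0" for x
    using b(1) by (metis invertible_det_nz matrix_left_invertible_ker invertible_def)
  have "x = 0" if "Z *v x = 0" for x
  proof -
    define r where "r = (1 + t) * (\<Sum>j\<in>UNIV. x $ j) / t"
    have "t *\<^sub>R (b *v x) = t *\<^sub>R (r *\<^sub>R 1)"
      using that t by (simp add: Zv r_def)
    then have "b *v x = r *\<^sub>R 1"
      using t by (simp only: scaleR_cancel_left)  auto
    then have "b *v (x - r *\<^sub>R u) = 0"
      by (simp add: matrix_vector_mult_diff_distrib matrix_vector_mult_scaleR b(2))
    then have x: "x = r *\<^sub>R u"
      using inj_b by fastforce
    then have "(\<Sum>j\<in>UNIV. x $ j) = r * s"
      by (simp add: s_def sum_distrib_left)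
    \<comment> \<open>Insert the coordinate sum \<open>r * s\<close> of \<open>x\<close> into the
      definition of \<open>r\<close>, which then reads
      \<open>r * t = (1 + t) * (r * s)\<close>.\<close>
    then have "r * ((1 + t) * s - t) = 0"
      using t by (simp add: r_def field_simps)
    then show "x = 0"
      using c x by (simp add: s_def)
  qed
  then show inv: "invertible Z"
    by (metis invertible_left_inverse matrix_left_invertible_ker)
  have "Z *v u = ((1 + t) * s - t) *\<^sub>R 1"
    by (simp add: Zv b(2) s_def scaleR_diff_left)
  then have "Z *v ((1 / ((1 + t) * s - t)) *\<^sub>R u) = 1"
    using c by (simp add: matrix_vector_mult_scaleR s_def)
  then have "matrix_inv Z *v 1 = (matrix_inv Z ** Z) *v ((1 / ((1 + t) * s - t)) *\<^sub>R u)"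
    by (metis matrix_vector_mul_assoc)
  then show "matrix_inv Z *v 1 = (1 / ((1 + t) * (\<Sum>j\<in>UNIV. u $ j) - t)) *\<^sub>R u"
    using matrix_inv_left_inverse[OF inv] by (simp add: s_def)
qed

text \<open>Here \<open>1\<close> is the all-ones matrix, not the identity. The second condition says
  \<open>1\<^sup>T adj(D) 1 \<noteq> 0\<close>, i.e. that the Cayley--Menger determinant with entries \<open>d\<^sub>i\<^sub>j\<close> is nonzero.\<close>

definition generic_matrix :: "real ^ 'n ^ 'n \<Rightarrow> bool" where
  "generic_matrix D \<longleftrightarrow>
    det (D + 1) \<noteq> 0 \<and> (\<Sum>k\<in>UNIV. ones_column_det (D + 1) k) \<noteq> 0"

section \<open>Convergence of the weighting for generic matrices\<close>

lemma generic_matrix_admits_microscopic_weighting: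
  fixes D :: "real ^ 'n ^ 'n"
  assumes "generic_matrix D"
  shows "admits_microscopic_weighting D"
proof -
  define b where "b t = (1 + (1 / t) *\<^sub>R (1 - similarity_matrix D t) :: real ^ 'n ^ 'n)" for t
  define u where "u t = (\<chi> k. ones_column_det (b t) k / det (b t))" for t
  define v where "v = (\<chi> k. ones_column_det (D + 1) k / det (D + 1))"
  define c where "c t = (1 + t) * (\<Sum>j\<in>UNIV. u t $ j) - t" for t
  have det_D: "det (D + 1) \<noteq> 0"
    using assms by (simp add: generic_matrix_def)
  have sum_v: "(\<Sum>j\<in>UNIV. v $ j) \<noteq> 0"
    using assms by (simp add: generic_matrix_def v_def flip: sum_divide_distrib)
  have b_lim: "((\<lambda>t. b t $ i $ j) \<longlongrightarrow> (D + 1) $ i $ j) (at_right 0)" for i j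
  proof -
    \<comment> \<open>Up to sign, the entries of \<open>(1 - similarity_matrix D t) / t\<close> are
      difference quotients of the exponential at 0.\<close>
    have "((\<lambda>t. exp (- t * D $ i $ j)) has_real_derivative - D $ i $ j) (at 0)"
      by (auto intro!: derivative_eq_intros)
    then have "((\<lambda>t. (exp (- t * D $ i $ j) - 1) / t) \<longlongrightarrow> - D $ i $ j) (at 0)"
      by (simp add: DERIV_def)
    then have "((\<lambda>t. 1 - (exp (- t * D $ i $ j) - 1) / t) \<longlongrightarrow> 1 - (- D $ i $ j)) (at_right 0)"
      by (intro tendsto_intros) (auto intro: filterlim_at_split[THEN iffD1, THEN conjunct2])
    moreover have "b t $ i $ j = 1 - (exp (- t * D $ i $ j) - 1) / t" for t
      by (simp add: b_def similarity_matrix_def diff_divide_distrib)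
    ultimately show ?thesis
      by (simp add: add.commute)
  qed
  have det_lim: "((\<lambda>t. det (b t)) \<longlongrightarrow> det (D + 1)) (at_right 0)"
    by (rule tendsto_det) (rule b_lim)
  have u_lim: "((\<lambda>t. u t $ i) \<longlongrightarrow> v $ i) (at_right 0)" for i
    unfolding u_def v_def vec_lambda_beta
    by (intro tendsto_divide tendsto_ones_column_det det_lim b_lim det_D)
  have "(c \<longlongrightarrow> (1 + 0) * (\<Sum>j\<in>UNIV. v $ j) - 0) (at_right 0)"
    unfolding c_def by (intro tendsto_intros u_lim)
  then have c_lim: "(c \<longlongrightarrow> (\<Sum>j\<in>UNIV. v $ j)) (at_right 0)"
    by simp
  \<comment> \<open>Since their limits are nonzero, \<open>det (b t)\<close> and \<open>c t\<close>
    are nonzero for small \<open>t > 0\<close>.\<close>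
  have w: "\<forall>\<^sub>F t in at_right 0. invertible (similarity_matrix D t) \<and>
      weighting D t = (1 / c t) *\<^sub>R u t"
    using tendsto_imp_eventually_ne[OF det_lim det_D] tendsto_imp_eventually_ne[OF c_lim sum_v]
      eventually_at_right_less
  proof eventually_elim
    case (elim t)
    have "similarity_matrix D t = (1 + t) *\<^sub>R 1 - t *\<^sub>R b t"
      using elim by (simp add: b_def algebra_simps)
    moreover have "b t *v u t = 1"
      using elim matrix_vector_eq_one_iff by (metis u_def)
    moreover have "(\<chi> i. 1) = (1 :: real ^ 'n)"
      by (simp add: vec_eq_iff)
    ultimately show ?case
      using invertible_ones_minus_matrix[of "similarity_matrix D t" t "b t" "u t"] elim
      by (simp add: c_def weighting_def)
  qed
  have "((\<lambda>t. weighting D t $ i) \<longlongrightarrow> ((1 / (\<Sum>j\<in>UNIV. v $ j)) *\<^sub>R v) $ i) (at_right 0)" for i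
  proof -
    have "((\<lambda>t. 1 / c t * u t $ i) \<longlongrightarrow> 1 / (\<Sum>j\<in>UNIV. v $ j) * v $ i) (at_right 0)"
      by (intro tendsto_intros c_lim u_lim sum_v)
    moreover have "\<forall>\<^sub>F t in at_right 0. 1 / c t * u t $ i = weighting D t $ i"
      using w by eventually_elim simp
    ultimately show ?thesis
      by (simp add: tendsto_cong)
  qed
  moreover have "\<forall>\<^sub>F t in at_right 0. invertible (similarity_matrix D t)"
    using w by eventually_elim simp
  ultimately show ?thesis
    unfolding admits_microscopic_weighting_def by blast
qed

section \<open>Openness and density of the generic metrics\<close>

lemma open_generic_matrix: "open {D :: real ^ 'n ^ 'n. generic_matrix D}"
proof -
  have "isCont (\<lambda>D :: real ^ 'n ^ 'n. det (D + 1)) A" for A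
    unfolding isCont_def by (rule tendsto_det) (auto intro!: tendsto_intros)
  moreover have "isCont (\<lambda>D :: real ^ 'n ^ 'n. \<Sum>k\<in>UNIV. ones_column_det (D + 1) k) A" for A
    unfolding isCont_def
    by (intro tendsto_sum tendsto_ones_column_det) (auto intro!: tendsto_intros)
  ultimately show ?thesis
    unfolding generic_matrix_def
    by (intro open_Collect_conj open_Collect_neq continuous_at_imp_continuous_on) auto
qed

text \<open>The shifted matrix is 2J - I, which multiplies constant vectors by 2n - 1. This factor
  is positive even for n = 1; without the shift it would be n - 1.\<close>

lemma generic_matrix_discrete: "generic_matrix (1 - mat 1 :: real ^ 'n ^ 'n)"
proof -
  let ?A = "1 - mat 1 + 1 :: real ^ 'n ^ 'n"
  define n where "n = real CARD('n)"
  have n: "n \<ge> 1"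
    by (simp add: n_def Suc_leI)
  have A: "?A *v x = (2 * (\<Sum>j\<in>UNIV. x $ j)) *\<^sub>R 1 - x" for x
    unfolding matrix_vector_mult_add_rdistrib matrix_vector_mult_diff_rdistrib
      one_matrix_vector_mult matrix_vector_mul_lid
    by (simp add: vec_eq_iff)
  have "x = 0" if "?A *v x = 0" for x
  proof -
    define s where "s = (\<Sum>j\<in>UNIV. x $ j)"
    have x: "x $ j = 2 * s" for j
      using that unfolding A s_def [symmetric] by (simp add: vec_eq_iff)
    have "s = (\<Sum>j\<in>(UNIV :: 'n set). 2 * s)"
      by (subst s_def) (simp add: x)
    then have "s * (2 * n - 1) = 0"
      by (simp add: n_def algebra_simps)
    then show "x = 0"
      using n by (simp add: x vec_eq_iff)
  qed
  then have "invertible ?A"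
    by (metis invertible_left_inverse matrix_left_invertible_ker)
  then have det: "det ?A \<noteq> 0"
    by (simp add: invertible_det_nz)
  define u :: "real ^ 'n" where "u = (1 / (2 * n - 1)) *\<^sub>R 1"
  have "?A *v u = 1"
    using n unfolding A by (simp add: u_def vec_eq_iff flip: n_def diff_divide_distrib)
  then have "u = (\<chi> k. ones_column_det ?A k / det ?A)"
    using det matrix_vector_eq_one_iff by blast
  then have "(\<Sum>k\<in>UNIV. ones_column_det ?A k) / det ?A = (\<Sum>k\<in>UNIV. u $ k)"
    by (simp add: sum_divide_distrib)
  also have "\<dots> \<noteq> 0"
    using n by (simp add: u_def flip: n_def)
  finally show ?thesis
    using det by (simp add: generic_matrix_def)
qed

text \<open>Keeps the segment to the discrete metric inside the space. Positivity off the diagonal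
  survives because \<open>p\<close> and \<open>q\<close> cannot both vanish, hence the case
  split.\<close>

lemma convex_metric_matrices: "convex (metric_matrices :: (real ^ 'n ^ 'n) set)"
proof (rule convexI)
  fix A B :: "real ^ 'n ^ 'n" and p q :: real
  assume A: "A \<in> metric_matrices" and B: "B \<in> metric_matrices"
    and pq: "0 \<le> p" "0 \<le> q" "p + q = 1"
  have "0 < p * A $ i $ j + q * B $ i $ j" if "i \<noteq> j" for i j
  proof (cases "p = 0")
    case True
    then show ?thesis using B pq that by (simp add: metric_matrices_iff)
  next
    case False
    then have "0 < p * A $ i $ j" "0 \<le> q * B $ i $ j"
      using A B pq that by (auto simp: metric_matrices_iff less_imp_le)
    then show ?thesis by linarith
  qed
  moreover have "p * A $ i $ k + q * B $ i $ k
      \<le> p * A $ i $ j + q * B $ i $ j + (p * A $ j $ k + q * B $ j $ k)" for i j k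
  proof -
    have "p * A $ i $ k \<le> p * (A $ i $ j + A $ j $ k)" "q * B $ i $ k \<le> q * (B $ i $ j + B $ j $ k)"
      using A B pq by (auto simp: metric_matrices_iff intro: mult_left_mono)
    then show ?thesis by (simp add: algebra_simps)
  qed
  moreover have "p * A $ i $ j + q * B $ i $ j = p * A $ j $ i + q * B $ j $ i" if "i \<noteq> j" for i j
    using A B that by (simp add: metric_matrices_iff)
  ultimately show "p *\<^sub>R A + q *\<^sub>R B \<in> metric_matrices"
    using A B by (simp add: metric_matrices_iff)
qed

lemma discrete_metric_matrix: "1 - mat 1 \<in> metric_matrices"
  by (auto simp: metric_matrices_iff mat_def)

lemma generic_metric_matrices_dense:
  fixes D :: "real ^ 'n ^ 'n"
  assumes D: "D \<in> metric_matrices"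
  shows "D \<in> closure {A \<in> metric_matrices. generic_matrix A}"
proof -
  define f where "f s = (1 - s) *\<^sub>R D + s *\<^sub>R (1 - mat 1)" for s :: real
  have entry: "real_polynomial_function (\<lambda>s. (f s + 1) $ i $ j)" for i j
  proof -
    have eq: "(\<lambda>s. (f s + 1) $ i $ j) =
        (\<lambda>s. (1 - s) * D $ i $ j + s * (1 - mat 1 :: real ^ 'n ^ 'n) $ i $ j + 1)"
      by (simp add: f_def)
    have id: "real_polynomial_function (\<lambda>s :: real. s)"
      by (rule real_polynomial_function.intros(1)) (rule bounded_linear_ident)
    show ?thesis
      unfolding eq
      by (intro real_polynomial_function.intros(2-4) real_polynomial_function_diff id)
  qed
  let ?S = "{s. det (f s + 1) = 0} \<union> {s. (\<Sum>k\<in>UNIV. ones_column_det (f s + 1) k) = 0}"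
  have f1: "generic_matrix (f 1)"
    using generic_matrix_discrete by (simp add: f_def)
  have "finite ?S"
    unfolding finite_Un
  proof
    show "finite {s. det (f s + 1) = 0}"
      using f1 by (intro finite_roots_real_polynomial_function[of _ 1]
          real_polynomial_function_det entry) (simp add: generic_matrix_def)
    show "finite {s. (\<Sum>k\<in>UNIV. ones_column_det (f s + 1) k) = 0}"
      using f1 by (intro finite_roots_real_polynomial_function[of _ 1]
          real_polynomial_function_sum real_polynomial_function_ones_column_det entry)
        (simp_all add: generic_matrix_def)
  qed
  \<comment> \<open>The point 0 may itself be a root, as \<open>D\<close> need not be generic; only
    small \<open>s > 0\<close> must avoid the roots.\<close>
  then have "\<not> 0 islimpt ?S"
    by (rule islimpt_finite)
  then have "\<forall>\<^sub>F s in at_right 0. s \<notin> ?S"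
    unfolding islimpt_iff_eventually eventually_at_split not_not by (rule conjunct2)
  then have generic_near: "\<forall>\<^sub>F s in at_right 0. f s \<in> {A \<in> metric_matrices. generic_matrix A}"
    using eventually_at_right_real[OF zero_less_one]
  proof eventually_elim
    case (elim s)
    then have "f s \<in> metric_matrices"
      unfolding f_def
      by (intro convexD[OF convex_metric_matrices] D discrete_metric_matrix) auto
    with elim show ?case
      by (simp add: generic_matrix_def)
  qed
  have "(f \<longlongrightarrow> (1 - 0) *\<^sub>R D + 0 *\<^sub>R (1 - mat 1)) (at_right 0)"
    unfolding f_def by (intro tendsto_intros)
  then have "(f \<longlongrightarrow> D) (at_right 0)"
    by simp
  moreover have "\<forall>\<^sub>F s in at_right 0. f s \<in> closure {A \<in> metric_matrices. generic_matrix A}"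
    using generic_near by eventually_elim (rule subsetD[OF closure_subset])
  ultimately show ?thesis
    by (intro Lim_in_closed_set[of _ f "at_right 0"]) auto
qed

theorem mainTheorem3:
  "\<exists>U :: (real ^ 'n ^ 'n) set.
     openin (top_of_set metric_matrices) U \<and>
     top_of_set metric_matrices closure_of U = metric_matrices \<and>
     (\<forall>D \<in> U. admits_microscopic_weighting D)"
proof (intro exI conjI ballI)
  let ?U = "{A \<in> metric_matrices. generic_matrix A} :: (real ^ 'n ^ 'n) set"
  have "?U = metric_matrices \<inter> {A. generic_matrix A}"
    by blast
  then show "openin (top_of_set metric_matrices) ?U"
    using open_generic_matrix by (metis openin_open_Int)
  \<comment> \<open>The closure of a set in a subspace is computed from its intersection with that
    subspace; here the intersection changes nothing.\<close>
  have "metric_matrices \<inter> ?U = ?U"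
    by blast
  then show "top_of_set metric_matrices closure_of ?U = metric_matrices"
    using generic_metric_matrices_dense by (auto simp: closure_of_subtopology)
  show "admits_microscopic_weighting D" if "D \<in> ?U" for D
    using that by (simp add: generic_matrix_admits_microscopic_weighting)
qed

end
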